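(* For any integers $0\le q \le m$ we have $$\binom{2m}{2q} = \sum_{j=0}^q 4^j \, \binom{m-2j}{q-j} \binom{m}{2j} = \sum_{j=0}^q 4^j \, \binom{m}{q+j} \binom{q+j}{2j},$$ and, if moreover $q<m$, $$\binom{2m}{2q+1} = 2\sum_{j=0}^q 4^j \, \binom{m-2j-1}{q-j} \binom{m}{2j+1} = 2\sum_{j=0}^q 4^j \, \binom{m}{q+j+1} \binom{q+j+1}{2j+1}.$$
   Context: For an integer $x$ (possibly negative) and $i\in\mathbb{N}_0$, $\binom{x}{i} = x(x-1)\cdots(x-i+1)/i!$ for $i\ge 1$ and $\binom{x}{0}=1$. *)

theory Defs imports Complex_Main begin

end

(* Compare coefficients in (1 + x)^(2m) = (2x + (1 + x^2))^m. The second equality in each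
   line is the trinomial revision, term by term. *)

theory Submission
  imports Defs "HOL-Computational_Algebra.Polynomial"
begin

text \<open>Picking \<open>n\<close> of \<open>2 * m\<close> elements arranged in \<open>m\<close>
  pairs, let \<open>k\<close> pairs give one element (two ways each) and \<open>i\<close> pairs
  both, so \<open>k + 2 * i = n\<close>. This count is \<open>double_choose_eq_sum\<close>, obtained
  by comparing coefficients. Taking \<open>n = 2 * q + r\<close> with \<open>r\<close> the parity
  forces \<open>k = 2 * j + r\<close>, whence the powers of 4 and, for odd \<open>n\<close>, the
  factor 2.\<close>

lemma coeff_one_plus_square_power:
  "coeff (([:1, 0, 1:] :: nat poly) ^ r) d = (if even d then r choose (d div 2) else 0)"
proof -
  have eq: "([:1, 0, 1:] :: nat poly) = monom 1 2 + 1"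
    by (simp add: monom_altdef numeral_2_eq_2 one_pCons)
  have "coeff (([:1, 0, 1:] :: nat poly) ^ r) d
      = (\<Sum>i\<le>r. (r choose i) * (if 2 * i = d then Suc 0 else 0))"
    unfolding eq binomial_ring
    by (simp add: coeff_sum monom_power of_nat_poly)
  also have "\<dots> = (\<Sum>i\<le>r. if i = d div 2 then (if even d then r choose i else 0) else 0)"
    by (intro sum.cong) auto
  also have "\<dots> = (if even d then r choose (d div 2) else 0)"
    by (simp add: sum.delta not_le)
  finally show ?thesis .
qed

text \<open>In \<open>(2x + (1 + x^2))^m\<close>, the term with \<open>k\<close> factors
  \<open>2x\<close> needs the coefficient of \<open>x^(n - k)\<close> in
  \<open>(1 + x^2)^(m - k)\<close>, which is nonzero only for \<open>n - k = 2 * i\<close>.\<close>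

lemma double_choose_eq_sum:
  "(2 * m) choose n
    = (\<Sum>i\<le>n div 2. 2 ^ (n - 2 * i) * (m choose (n - 2 * i)) * ((m - (n - 2 * i)) choose i))"
proof -
  define t where "t k i = 2 ^ k * (m choose k) * ((m - k) choose i)" for k i
  have sq: "([:1, 1:] :: nat poly) ^ (2 * m) = (monom 2 1 + [:1, 0, 1:]) ^ m"
    unfolding power_mult by (simp add: power2_eq_square monom_altdef numeral_2_eq_2)
  have "(2 * m) choose n = coeff (([:1, 1:] :: nat poly) ^ (2 * m)) n"
    by (cases "n \<le> 2 * m") (simp_all add: coeff_linear_poly_power coeff_eq_0 degree_linear_power del: One_nat_def)
  also have "\<dots> = (\<Sum>k\<le>m. (m choose k) *
      (if k \<le> n then 2 ^ k * (if even (n - k) then (m - k) choose ((n - k) div 2) else 0) else 0))"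
    unfolding sq binomial_ring
    by (simp add: coeff_sum monom_power of_nat_poly coeff_monom_mult mult.assoc
        coeff_one_plus_square_power not_le del: One_nat_def cong: if_cong)
      (rule sum.cong; simp)
  also have "\<dots> = (\<Sum>k | k \<le> m \<and> k \<le> n \<and> even (n - k). t k ((n - k) div 2))"
    by (rule sum.mono_neutral_cong_right) (auto simp: t_def)
  \<comment> \<open>The bound \<open>k \<le> m\<close> can go because \<open>m choose k\<close>
    vanishes beyond it.\<close>
  also have "\<dots> = (\<Sum>k | k \<le> n \<and> even (n - k). t k ((n - k) div 2))"
    by (rule sum.mono_neutral_left) (auto simp: t_def)
  also have "\<dots> = (\<Sum>i\<le>n div 2. t (n - 2 * i) i)"
    by (rule sum.reindex_bij_witness[of _ "\<lambda>i. n - 2 * i" "\<lambda>k. (n - k) div 2"]) auto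
  finally show ?thesis
    by (simp add: t_def)
qed

text \<open>For \<open>k > m\<close> the natural \<open>m - k\<close> truncates to 0 while the real
  difference is negative, so the two factors may differ; but choosing \<open>k\<close> from
  \<open>m\<close> gives 0 and annihilates both sides.\<close>

lemma real_choose_mult_gbinomial_diff:
  "real ((m choose k) * ((m - k) choose i)) = ((real m - real k) gchoose i) * (real m gchoose k)"
  by (cases "k \<le> m") (simp_all add: binomial_gbinomial[symmetric] binomial_gbinomial[of "m - k"] of_nat_diff)

text \<open>Treats both parities at once: \<open>r < 2\<close> makes
  \<open>(2 * q + r) div 2 = q\<close>, and \<open>2 ^ (2 * j + r)\<close> splits as
  \<open>2 ^ r * 4 ^ j\<close>.\<close>

lemma gbinomial_double_eq_sum:
  assumes "r < 2"
  shows "(2 * real m) gchoose (2 * q + r)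
    = 2 ^ r * (\<Sum>j=0..q. 4 ^ j * ((real m - real (2 * j + r)) gchoose (q - j))
                            * (real m gchoose (2 * j + r)))"
proof -
  have "(2 * real m) gchoose (2 * q + r) = real ((2 * m) choose (2 * q + r))"
    by (simp add: binomial_gbinomial)
  also have "\<dots> = (\<Sum>i\<le>q. real (2 ^ (2 * q + r - 2 * i) * ((m choose (2 * q + r - 2 * i)) *
      ((m - (2 * q + r - 2 * i)) choose i))))"
    using assms unfolding double_choose_eq_sum by (simp add: mult.assoc)
  also have "\<dots> = (\<Sum>j=0..q. real (2 ^ (2 * j + r) * ((m choose (2 * j + r)) *
      ((m - (2 * j + r)) choose (q - j)))))"
    \<comment> \<open>With \<open>j = q - i\<close>, the number of singly used pairs
      \<open>2 * q + r - 2 * i\<close> becomes \<open>2 * j + r\<close>.\<close>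
    by (rule sum.reindex_bij_witness[of _ "\<lambda>j. q - j" "\<lambda>i. q - i"])
      (auto simp: diff_mult_distrib2)
  also have "\<dots> = (\<Sum>j=0..q. 2 ^ r * (4 ^ j * ((real m - real (2 * j + r)) gchoose (q - j))
                            * (real m gchoose (2 * j + r))))"
    unfolding of_nat_mult[of "2 ^ _"] real_choose_mult_gbinomial_diff
    by (intro sum.cong refl) (simp add: power_add power_mult del: of_nat_add)
  finally show ?thesis
    by (simp add: sum_distrib_left)
qed

text \<open>Termwise, choosing \<open>q + j + r\<close> and then \<open>2 * j + r\<close> among them
  amounts to choosing the \<open>2 * j + r\<close> first and then the other \<open>q - j\<close>; as
  a polynomial identity this holds for every real \<open>a\<close>.\<close>

lemma sum_trinomial_revision:
  fixes a :: real
  shows "(\<Sum>j=0..q. 4 ^ j * ((a - real (2 * j + r)) gchoose (q - j)) * (a gchoose (2 * j + r)))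
    = (\<Sum>j=0..q. 4 ^ j * (a gchoose (q + j + r)) * (real (q + j + r) gchoose (2 * j + r)))"
proof (rule sum.cong)
  fix j assume "j \<in> {0..q}"
  then have "2 * j + r \<le> q + j + r" "q + j + r - (2 * j + r) = q - j"
    by auto
  then show "4 ^ j * ((a - real (2 * j + r)) gchoose (q - j)) * (a gchoose (2 * j + r))
      = 4 ^ j * (a gchoose (q + j + r)) * (real (q + j + r) gchoose (2 * j + r))"
    using gbinomial_trinomial_revision[of "2 * j + r" "q + j + r" a] by (simp only: mult_ac)
qed simp

theorem lemma4p1:
  fixes m q :: nat
  assumes "q \<le> m"
  shows
    "((2 * real m) gchoose (2 * q)
        = (\<Sum>j=0..q. 4 ^ j * ((real m - 2 * real j) gchoose (q - j)) * (real m gchoose (2 * j)))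
      \<and> (\<Sum>j=0..q. 4 ^ j * ((real m - 2 * real j) gchoose (q - j)) * (real m gchoose (2 * j)))
        = (\<Sum>j=0..q. 4 ^ j * (real m gchoose (q + j)) * (real (q + j) gchoose (2 * j))))
    \<and> (q < m \<longrightarrow>
        (2 * real m) gchoose (2 * q + 1)
          = 2 * (\<Sum>j=0..q. 4 ^ j * ((real m - 2 * real j - 1) gchoose (q - j))
                              * (real m gchoose (2 * j + 1)))
        \<and> 2 * (\<Sum>j=0..q. 4 ^ j * ((real m - 2 * real j - 1) gchoose (q - j))
                              * (real m gchoose (2 * j + 1)))
          = 2 * (\<Sum>j=0..q. 4 ^ j * (real m gchoose (q + j + 1))
                              * (real (q + j + 1) gchoose (2 * j + 1))))"
  using gbinomial_double_eq_sum[of 0 m q] gbinomial_double_eq_sum[of 1 m q]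
    sum_trinomial_revision[of "real m" 0 q] sum_trinomial_revision[of "real m" 1 q]
  by (simp add: algebra_simps)

end
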